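(* Consider the statements (B-cp-ms), (B-cp-bdms), (E-cp-ms) and (AI-lin-rsms) given in the context. Then (B-cp-ms) is deducible from (B-cp-bdms), (B-cp-bdms) is deducible from (E-cp-ms), (E-cp-ms) is deducible from (AI-lin-rsms), and (AI-lin-rsms) is deducible from (B-cp-ms). Hence the statements (B-cp-ms), (B-cp-bdms), (E-cp-ms) and (AI-lin-rsms) are mutually equivalent.
   Context: "Deducible from" means "implied by", each statement being universally quantified over all the data it mentions. For a map $T:X\to X$, $\mathrm{Fix}(T)=\{x\in X:Tx=x\}$. $T$ is global strongly Picard (modulo $d$) if for each $x\in X$ the sequence $(T^nx)_{n\ge0}$ is $d$-convergent with limit in $\mathrm{Fix}(T)$, and $z_1,z_2\in\mathrm{Fix}(T)$ implies $z_1=z_2$. For a relation $\mathcal B$ on $X$: $x\mathcal B^\omega y$ iff there are $k\ge2$ and $z_1,\dots,z_k\in X$ with $z_1=x$, $z_k=y$, $z_i\mathcal B z_{i+1}$ for $1\le i\le k-1$; $T$ is $(d,\mathcal B;\lambda)$-contractive if $d(Tx,Ty)\le\lambda d(x,y)$ whenever $x\mathcal B y$; a sequence $(z_n)$ is $\mathcal B$-ascending if $z_i\mathcal B z_{i+1}$ for every $i$; $X$ is $(d,\mathcal B)$-complete if every $\mathcal B$-ascending $d$-Cauchy sequence is $d$-convergent in $X$; $\mathcal B$ is $d$-almost-selfclosed if, whenever $(z_n)$ is $\mathcal B$-ascending and $d$-converges to $z$, there is a subsequence $(w_n)$ of $(z_n)$ with $w_n\mathcal B z$ for all $n$; $T$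 is $\mathcal B$-increasing if $x\mathcal B y$ implies $Tx\mathcal B Ty$; $T$ is $\mathcal B$-semi-progressive if $X(T,\mathcal B)=\{x\in X: x\mathcal B Tx\}$ is nonempty; $T$ is $\mathcal B^\omega$-global strongly Picard (modulo $(d,\mathcal B^\omega)$) if for each $x\in X(T,\mathcal B^\omega)$ the sequence $(T^nx)_{n\ge0}$ is $d$-convergent with limit in $\mathrm{Fix}(T)$, and for all $z_1,z_2\in\mathrm{Fix}(T)$, $z_1\mathcal B^\omega z_2$ implies $z_1=z_2$. For $\varepsilon>0$, $[d<\varepsilon]$ is the relation on $X$: $x[d<\varepsilon]y$ iff $d(x,y)<\varepsilon$. The statements (with $X$ a nonempty set, $d$ a metric on $X$, $T:X\to X$): (B-cp-ms): if $X$ is $d$-complete and there is $\alpha\in[0,1)$ with $d(Tx,Ty)\le\alpha d(x,y)$ for all $x,y\in X$, then $T$ is global strongly Picard (modulo $d$). (B-cp-bdms): if $X$ is bounded ($\operatorname{diam}(X)<\infty$) and $d$-complete, and there is $\alpha\in[0,1)$ with $d(Tx,Ty)\le\alpha d(x,y)$ for all $x,y\in X$, then $T$ is global strongly Picard (modulo $d$). (E-cp-ms): for every $\varepsilon>0$, if $T$ is $(d,[d<\varepsilon];\lambda)$-contractive for some $\lambda\in(0,1)$, $X$ is $d$-complete, and $T$ is $[d<\varepsilon]^\omega$-semi-progressive, then $T$ is $[d<\varepsilon]^\omega$-global strongly Picard (modulo $(d,[d<\varepsilon]^\omega)$). (AI-lin-rsms): for every reflexive symmetric relation $\mathcal S$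 on $X$, if $T$ is $(d,\mathcal S;\lambda)$-contractive for some $\lambda\in(0,1)$, $X$ is $(d,\mathcal S)$-complete, $\mathcal S$ is $d$-almost-selfclosed, and $T$ is $\mathcal S$-increasing and $\mathcal S^\omega$-semi-progressive, then $T$ is $\mathcal S^\omega$-global strongly Picard (modulo $(d,\mathcal S^\omega)$). *)

theory Defs
  imports "HOL-Analysis.Analysis"
begin

(* A metric space is a carrier X :: 'a set with Metric_space X d. That locale also asks for
   d x y >= 0 and d x y = d y x outside X; this is no restriction, since every metric on X
   extends by 0 to such a d, and only the values of d on X are used below.
   A relation on X is a set of pairs contained in X \<times> X. *)

definition Fix :: "'a set \<Rightarrow> ('a \<Rightarrow> 'a) \<Rightarrow> 'a set" where
  "Fix X T = {x \<in> X. T x = x}"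

definition converges_to :: "'a set \<Rightarrow> ('a \<Rightarrow> 'a \<Rightarrow> real) \<Rightarrow> (nat \<Rightarrow> 'a) \<Rightarrow> 'a \<Rightarrow> bool" where
  "converges_to X d \<sigma> z \<longleftrightarrow> limitin (Metric_space.mtopology X d) \<sigma> z sequentially"

definition global_strongly_Picard ::
    "'a set \<Rightarrow> ('a \<Rightarrow> 'a \<Rightarrow> real) \<Rightarrow> ('a \<Rightarrow> 'a) \<Rightarrow> bool" where
  "global_strongly_Picard X d T \<longleftrightarrow>
     (\<forall>x\<in>X. \<exists>z\<in>Fix X T. converges_to X d (\<lambda>n. (T ^^ n) x) z) \<and>
     (\<forall>z1\<in>Fix X T. \<forall>z2\<in>Fix X T. z1 = z2)"

definition chain_rel :: "'a set \<Rightarrow> 'a rel \<Rightarrow> 'a rel" where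
  "chain_rel X B = {(x, y). \<exists>k::nat. \<exists>z :: nat \<Rightarrow> 'a. 2 \<le> k \<and> (\<forall>i\<in>{1..k}. z i \<in> X) \<and>
     z 1 = x \<and> z k = y \<and> (\<forall>i\<in>{1..k-1}. (z i, z (i + 1)) \<in> B)}"

definition contractive ::
    "'a set \<Rightarrow> ('a \<Rightarrow> 'a \<Rightarrow> real) \<Rightarrow> 'a rel \<Rightarrow> real \<Rightarrow> ('a \<Rightarrow> 'a) \<Rightarrow> bool" where
  "contractive X d B lam T \<longleftrightarrow>
     (\<forall>x\<in>X. \<forall>y\<in>X. (x, y) \<in> B \<longrightarrow> d (T x) (T y) \<le> lam * d x y)"

definition ascending :: "'a rel \<Rightarrow> (nat \<Rightarrow> 'a) \<Rightarrow> bool" where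
  "ascending B \<sigma> \<longleftrightarrow> (\<forall>i. (\<sigma> i, \<sigma> (Suc i)) \<in> B)"

definition rel_complete :: "'a set \<Rightarrow> ('a \<Rightarrow> 'a \<Rightarrow> real) \<Rightarrow> 'a rel \<Rightarrow> bool" where
  "rel_complete X d B \<longleftrightarrow>
     (\<forall>\<sigma>. ascending B \<sigma> \<and> Metric_space.MCauchy X d \<sigma> \<longrightarrow> (\<exists>z\<in>X. converges_to X d \<sigma> z))"

definition almost_selfclosed :: "'a set \<Rightarrow> ('a \<Rightarrow> 'a \<Rightarrow> real) \<Rightarrow> 'a rel \<Rightarrow> bool" where
  "almost_selfclosed X d B \<longleftrightarrow>
     (\<forall>\<sigma> z. ascending B \<sigma> \<and> converges_to X d \<sigma> z \<longrightarrow>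
        (\<exists>r :: nat \<Rightarrow> nat. strict_mono r \<and> (\<forall>n. (\<sigma> (r n), z) \<in> B)))"

definition rel_increasing :: "'a set \<Rightarrow> 'a rel \<Rightarrow> ('a \<Rightarrow> 'a) \<Rightarrow> bool" where
  "rel_increasing X B T \<longleftrightarrow> (\<forall>x\<in>X. \<forall>y\<in>X. (x, y) \<in> B \<longrightarrow> (T x, T y) \<in> B)"

definition progress_set :: "'a set \<Rightarrow> 'a rel \<Rightarrow> ('a \<Rightarrow> 'a) \<Rightarrow> 'a set" where
  "progress_set X B T = {x \<in> X. (x, T x) \<in> B}"

definition semi_progressive :: "'a set \<Rightarrow> 'a rel \<Rightarrow> ('a \<Rightarrow> 'a) \<Rightarrow> bool" where
  "semi_progressive X B T \<longleftrightarrow> progress_set X B T \<noteq> {}"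

(* Used with R = chain_rel X B. *)
definition rel_global_strongly_Picard ::
    "'a set \<Rightarrow> ('a \<Rightarrow> 'a \<Rightarrow> real) \<Rightarrow> 'a rel \<Rightarrow> ('a \<Rightarrow> 'a) \<Rightarrow> bool" where
  "rel_global_strongly_Picard X d R T \<longleftrightarrow>
     (\<forall>x\<in>progress_set X R T. \<exists>z\<in>Fix X T. converges_to X d (\<lambda>n. (T ^^ n) x) z) \<and>
     (\<forall>z1\<in>Fix X T. \<forall>z2\<in>Fix X T. (z1, z2) \<in> R \<longrightarrow> z1 = z2)"

definition dist_less :: "'a set \<Rightarrow> ('a \<Rightarrow> 'a \<Rightarrow> real) \<Rightarrow> real \<Rightarrow> 'a rel" where
  "dist_less X d \<epsilon> = {(x, y). x \<in> X \<and> y \<in> X \<and> d x y < \<epsilon>}"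

definition B_cp_ms :: "'a itself \<Rightarrow> bool" where
  "B_cp_ms _ \<longleftrightarrow> (\<forall>(X :: 'a set) d T.
     X \<noteq> {} \<and> Metric_space X d \<and> T \<in> X \<rightarrow> X \<and>
     Metric_space.mcomplete X d \<and>
     (\<exists>\<alpha>. 0 \<le> \<alpha> \<and> \<alpha> < 1 \<and> (\<forall>x\<in>X. \<forall>y\<in>X. d (T x) (T y) \<le> \<alpha> * d x y))
     \<longrightarrow> global_strongly_Picard X d T)"

definition B_cp_bdms :: "'a itself \<Rightarrow> bool" where
  "B_cp_bdms _ \<longleftrightarrow> (\<forall>(X :: 'a set) d T.
     X \<noteq> {} \<and> Metric_space X d \<and> T \<in> X \<rightarrow> X \<and>
     Metric_space.mbounded X d X \<and> Metric_space.mcomplete X d \<and>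
     (\<exists>\<alpha>. 0 \<le> \<alpha> \<and> \<alpha> < 1 \<and> (\<forall>x\<in>X. \<forall>y\<in>X. d (T x) (T y) \<le> \<alpha> * d x y))
     \<longrightarrow> global_strongly_Picard X d T)"

definition E_cp_ms :: "'a itself \<Rightarrow> bool" where
  "E_cp_ms _ \<longleftrightarrow> (\<forall>(X :: 'a set) d T.
     X \<noteq> {} \<and> Metric_space X d \<and> T \<in> X \<rightarrow> X \<longrightarrow>
     (\<forall>\<epsilon>>0.
        (\<exists>lam. 0 < lam \<and> lam < 1 \<and> contractive X d (dist_less X d \<epsilon>) lam T) \<and>
        Metric_space.mcomplete X d \<and>
        semi_progressive X (chain_rel X (dist_less X d \<epsilon>)) T
        \<longrightarrow> rel_global_strongly_Picard X d (chain_rel X (dist_less X d \<epsilon>)) T))"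

definition AI_lin_rsms :: "'a itself \<Rightarrow> bool" where
  "AI_lin_rsms _ \<longleftrightarrow> (\<forall>(X :: 'a set) d T.
     X \<noteq> {} \<and> Metric_space X d \<and> T \<in> X \<rightarrow> X \<longrightarrow>
     (\<forall>S. S \<subseteq> X \<times> X \<and> refl_on X S \<and> sym S \<and>
        (\<exists>lam. 0 < lam \<and> lam < 1 \<and> contractive X d S lam T) \<and>
        rel_complete X d S \<and> almost_selfclosed X d S \<and>
        rel_increasing X S T \<and> semi_progressive X (chain_rel X S) T
        \<longrightarrow> rel_global_strongly_Picard X d (chain_rel X S) T))"

end

theory Submission
  imports Defs
begin

text \<open>
  The four implications form a cycle, and each is obtained by applying the assumed fixed point
  statement to a suitably chosen space or relation; no iteration of \<open>T\<close> is ever estimated.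

  The bounded principle gives the general one because a contraction with constant \<open>\<alpha>\<close> maps the
  closed ball about \<open>x\<close> of radius \<open>d x (T x) / (1 - \<alpha>)\<close> into itself, and this ball is bounded and
  complete and contains \<open>x\<close>. The statement about \<open>d x y < \<epsilon>\<close> gives the bounded principle, since for
  \<open>\<epsilon>\<close> larger than the diameter this relation is all of \<open>X \<times> X\<close>. It is itself an instance of the
  relational statement: \<open>d x y < \<epsilon>\<close> is reflexive and symmetric, a contractive map preserves it,
  and a sequence converging to \<open>z\<close> is eventually \<open>\<epsilon>\<close>-close to \<open>z\<close>.

  The substantial step is from the Banach principle to the relational statement. Chains of a
  reflexive symmetric relation \<open>S\<close> partition \<open>X\<close> into the classes of the transitive closure
  of \<open>S\<close>. Such a class carries a chain metric \<open>e\<close>: the infimum of the total \<open>d\<close>-lengths of the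
  \<open>S\<close>-chains joining two points. It satisfies \<open>d \<le> e\<close> on the class, and \<open>e \<le> d\<close> on pairs in \<open>S\<close>.
  An \<open>S\<close>-increasing map which contracts \<open>d\<close> on pairs in \<open>S\<close> shortens every chain by the
  contraction factor, so it contracts \<open>e\<close> (\<open>chain_dist_contractive\<close>). If \<open>x\<close> is
  joined to \<open>T x\<close>, then \<open>T\<close> maps the class of \<open>x\<close> into itself, and as soon as \<open>e\<close> is complete there the
  Banach principle yields a fixed point to which the iterates of \<open>x\<close> converge, with respect to \<open>e\<close>
  and a fortiori to \<open>d\<close>. Its uniqueness part, applied to the class of a fixed point, says that two
  fixed points joined by a chain coincide.

  Completeness of \<open>e\<close> (\<open>mcomplete_component\<close>) is where completeness along ascending sequences and
  almost-selfclosedness enter. An \<open>e\<close>-Cauchy sequence is not ascending, but consecutive terms of a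
  rapidly converging subsequence are joined by short chains, and putting all these chains one after
  the other (\<open>concatenate_chains\<close>) produces an ascending sequence of finite \<open>d\<close>-length. It has a
  \<open>d\<close>-limit \<open>z\<close>; infinitely many of its terms are \<open>S\<close>-related to \<open>z\<close>, and for these \<open>e \<le> d\<close> turns
  \<open>d\<close>-convergence into \<open>e\<close>-convergence.
\<close>

section \<open>Contractions of metric spaces\<close>

lemma contraction_fixed_points_eq:
  assumes "Metric_space X d" and "\<alpha> < 1"
    and contr: "\<forall>x\<in>X. \<forall>y\<in>X. d (T x) (T y) \<le> \<alpha> * d x y"
    and z: "z1 \<in> Fix X T" "z2 \<in> Fix X T"
  shows "z1 = z2"
proof -
  interpret Metric_space X d by fact
  have zX: "z1 \<in> X" "z2 \<in> X" "T z1 = z1" "T z2 = z2"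
    using z by (auto simp: Fix_def)
  then have "d z1 z2 \<le> \<alpha> * d z1 z2"
    using contr by metis
  then have "(1 - \<alpha>) * d z1 z2 \<le> 0"
    by (simp add: algebra_simps)
  with \<open>\<alpha> < 1\<close> have "d z1 z2 \<le> 0"
    by (simp add: mult_le_0_iff)
  then show ?thesis
    using zX zero nonneg by (metis order_antisym)
qed

text \<open>The radius \<open>R\<close> solves \<open>d x (T x) + \<alpha> * R = R\<close>, which is what the triangle inequality through
  \<open>T x\<close> requires.\<close>

lemma contraction_maps_ball:
  assumes "Metric_space X d" and T: "T \<in> X \<rightarrow> X" and x: "x \<in> X"
    and "0 \<le> \<alpha>" "\<alpha> < 1"
    and contr: "\<forall>x\<in>X. \<forall>y\<in>X. d (T x) (T y) \<le> \<alpha> * d x y"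
    and R: "R = d x (T x) / (1 - \<alpha>)"
  shows "T \<in> Metric_space.mcball X d x R \<rightarrow> Metric_space.mcball X d x R"
proof
  interpret Metric_space X d by fact
  fix y assume "y \<in> mcball x R"
  then have y: "y \<in> X" "d x y \<le> R"
    by auto
  have "d x (T y) \<le> d x (T x) + d (T x) (T y)"
    using x y T by (intro triangle) auto
  also have "d (T x) (T y) \<le> \<alpha> * R"
    using contr x y \<open>0 \<le> \<alpha>\<close> by (meson mult_left_mono order_trans)
  also have "d x (T x) + \<alpha> * R = R"
    using R \<open>\<alpha> < 1\<close> by (simp add: field_simps)
  finally show "T y \<in> mcball x R"
    using x y T by auto
qed

text \<open>The existence of a limit concerns the orbit of a single point, so it can be tested in the
  invariant ball about that point.\<close>

lemma B_cp_ms_if_B_cp_bdms: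
  assumes "B_cp_bdms TYPE('a)"
  shows "B_cp_ms TYPE('a)"
  unfolding B_cp_ms_def
proof (intro allI impI, elim conjE exE)
  fix X :: "'a set" and d T and \<alpha> :: real
  assume X: "Metric_space X d" and T: "T \<in> X \<rightarrow> X" and complete: "Metric_space.mcomplete X d"
    and \<alpha>: "0 \<le> \<alpha>" "\<alpha> < 1"
    and contr: "\<forall>x\<in>X. \<forall>y\<in>X. d (T x) (T y) \<le> \<alpha> * d x y"
  interpret Metric_space X d by fact
  show "global_strongly_Picard X d T"
    unfolding global_strongly_Picard_def
  proof (intro conjI ballI)
    fix x assume x: "x \<in> X"
    define R where "R = d x (T x) / (1 - \<alpha>)"
    define Y where "Y = mcball x R"
    have "0 \<le> R"
      using \<alpha> by (simp add: R_def)
    with x have xY: "x \<in> Y"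
      by (simp add: Y_def)
    interpret Submetric X d Y
      by unfold_locales (auto simp: Y_def)
    have "sub.mcomplete"
      using complete by (intro closedin_mcomplete_imp_mcomplete) (simp_all add: Y_def)
    moreover have "sub.mbounded Y"
      unfolding sub.mbounded_alt
      using mbounded_mcball[of x R] unfolding mbounded_alt Y_def[symmetric] by blast
    moreover have "T \<in> Y \<rightarrow> Y"
      unfolding Y_def using X T x \<alpha> contr R_def by (rule contraction_maps_ball)
    moreover have "\<forall>x\<in>Y. \<forall>y\<in>Y. d (T x) (T y) \<le> \<alpha> * d x y"
      using contr subset by blast
    ultimately have "global_strongly_Picard Y d T"
      using assms \<alpha> xY sub.Metric_space_axioms unfolding B_cp_bdms_def by blast
    then obtain z where z: "z \<in> Fix Y T" "converges_to Y d (\<lambda>n. (T ^^ n) x) z"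
      using xY unfolding global_strongly_Picard_def by blast
    have "z \<in> Fix X T"
      using z(1) subset by (auto simp: Fix_def)
    moreover have "converges_to X d (\<lambda>n. (T ^^ n) x) z"
      using z(2) by (simp add: converges_to_def limitin_submetric_iff)
    ultimately show "\<exists>z\<in>Fix X T. converges_to X d (\<lambda>n. (T ^^ n) x) z"
      by blast
  next
    fix z1 z2 assume "z1 \<in> Fix X T" "z2 \<in> Fix X T"
    then show "z1 = z2"
      by (rule contraction_fixed_points_eq[OF X \<alpha>(2) contr])
  qed
qed

section \<open>Chains of a relation\<close>

text \<open>Requiring \<open>k \<ge> 2\<close> vertices means at least one step, hence the transitive closure and not
  the reflexive transitive one.\<close>

lemma chain_rel_eq_trancl:
  assumes "B \<subseteq> X \<times> X"
  shows "chain_rel X B = B\<^sup>+"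
proof (intro set_eqI iffI; clarify)
  fix x y assume "(x, y) \<in> chain_rel X B"
  then obtain k :: nat and z where k: "2 \<le> k" and z: "z 1 = x" "z k = y"
    and step: "\<forall>i\<in>{1..k-1}. (z i, z (i + 1)) \<in> B"
    unfolding chain_rel_def by blast
  have "(z 1, z (j + 2)) \<in> B\<^sup>+" if "j + 2 \<le> k" for j
    using that
  proof (induction j)
    case 0
    then show ?case
      using bspec[OF step, of 1] by (simp add: numeral_2_eq_2 r_into_trancl)
  next
    case (Suc j)
    then show ?case
      using bspec[OF step, of "j + 2"] by (auto intro: trancl_into_trancl)
  qed
  moreover have "k - 2 + 2 = k"
    using k by simp
  ultimately show "(x, y) \<in> B\<^sup>+"
    using z by (metis order_refl)
next
  fix x y assume "(x, y) \<in> B\<^sup>+"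
  then show "(x, y) \<in> chain_rel X B"
  proof (induction rule: trancl_induct)
    case (base y)
    then show ?case
      unfolding chain_rel_def using assms
      by (auto intro!: exI[of _ "2::nat"] exI[of _ "\<lambda>i::nat. if i = 1 then x else y"])
  next
    case (step y w)
    then obtain k :: nat and z where k: "2 \<le> k" "\<forall>i\<in>{1..k}. z i \<in> X" "z 1 = x" "z k = y"
      "\<forall>i\<in>{1..k-1}. (z i, z (i + 1)) \<in> B"
      unfolding chain_rel_def by blast
    then show ?case
      unfolding chain_rel_def using assms step.hyps(2)
      by (auto intro!: exI[of _ "Suc k"] exI[of _ "z(Suc k := w)"] simp: le_Suc_eq)
  qed
qed

lemma dist_less_subset: "dist_less X d \<epsilon> \<subseteq> X \<times> X"
  by (auto simp: dist_less_def)

section \<open>The bounded case and the relation of being closer than a constant\<close>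

lemma B_cp_bdms_if_E_cp_ms:
  assumes "E_cp_ms TYPE('a)"
  shows "B_cp_bdms TYPE('a)"
  unfolding B_cp_bdms_def
proof (intro allI impI, elim conjE exE)
  fix X :: "'a set" and d T and \<alpha> :: real
  assume X: "X \<noteq> {}" "Metric_space X d" and T: "T \<in> X \<rightarrow> X"
    and bounded: "Metric_space.mbounded X d X" and complete: "Metric_space.mcomplete X d"
    and \<alpha>: "0 \<le> \<alpha>" "\<alpha> < 1"
    and contr: "\<forall>x\<in>X. \<forall>y\<in>X. d (T x) (T y) \<le> \<alpha> * d x y"
  interpret Metric_space X d by fact
  obtain D where D: "D > 0" "\<And>x y. x \<in> X \<Longrightarrow> y \<in> X \<Longrightarrow> d x y \<le> D"
    using bounded unfolding mbounded_alt_pos by blast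
  have total: "dist_less X d (D + 1) = X \<times> X"
    using D(2) by (fastforce simp: dist_less_def)
  have chain: "chain_rel X (dist_less X d (D + 1)) = X \<times> X"
    using trancl_subset_Sigma[of "X \<times> X" X]
    by (auto simp: chain_rel_eq_trancl total)
  have progress: "progress_set X (X \<times> X) T = X"
    using T by (auto simp: progress_set_def)
  \<comment> \<open>The contraction constant may be \<open>0\<close> here but has to be positive for the relational
    statement.\<close>
  have "contractive X d (dist_less X d (D + 1)) (max \<alpha> (1/2)) T"
    unfolding contractive_def
  proof (intro ballI impI)
    fix x y assume "x \<in> X" "y \<in> X"
    then have "d (T x) (T y) \<le> \<alpha> * d x y"
      using contr by blast
    also have "\<dots> \<le> max \<alpha> (1/2) * d x y"
      by (intro mult_right_mono) auto
    finally show "d (T x) (T y) \<le> max \<alpha> (1/2) * d x y" .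
  qed
  moreover have "0 < max \<alpha> (1/2)" "max \<alpha> (1/2) < 1"
    using \<alpha> by auto
  moreover have "semi_progressive X (chain_rel X (dist_less X d (D + 1))) T"
    using X(1) by (simp add: semi_progressive_def chain progress)
  moreover have "D + 1 > 0"
    using D(1) by simp
  ultimately have "rel_global_strongly_Picard X d (chain_rel X (dist_less X d (D + 1))) T"
    using assms X T complete unfolding E_cp_ms_def by blast
  then show "global_strongly_Picard X d T"
    unfolding rel_global_strongly_Picard_def global_strongly_Picard_def chain progress
    by (auto simp: Fix_def)
qed

lemma almost_selfclosed_dist_less:
  assumes "Metric_space X d" and "\<epsilon> > 0"
  shows "almost_selfclosed X d (dist_less X d \<epsilon>)"
  unfolding almost_selfclosed_def
proof (intro allI impI, elim conjE)
  interpret Metric_space X d by fact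
  fix \<sigma> z assume "converges_to X d \<sigma> z"
  then obtain N where "z \<in> X" "\<forall>n\<ge>N. \<sigma> n \<in> X \<and> d (\<sigma> n) z < \<epsilon>"
    using \<open>\<epsilon> > 0\<close> unfolding converges_to_def limit_metric_sequentially by blast
  then show "\<exists>r :: nat \<Rightarrow> nat. strict_mono r \<and> (\<forall>n. (\<sigma> (r n), z) \<in> dist_less X d \<epsilon>)"
    by (intro exI[of _ "\<lambda>n. N + n"]) (auto simp: dist_less_def strict_mono_def)
qed

lemma E_cp_ms_if_AI_lin_rsms:
  assumes "AI_lin_rsms TYPE('a)"
  shows "E_cp_ms TYPE('a)"
  unfolding E_cp_ms_def
proof (intro allI impI, elim conjE exE)
  fix X :: "'a set" and d T and \<epsilon> lam :: real
  assume X: "X \<noteq> {}" "Metric_space X d" and T: "T \<in> X \<rightarrow> X" and \<epsilon>: "\<epsilon> > 0"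
    and lam: "0 < lam" "lam < 1" and contr: "contractive X d (dist_less X d \<epsilon>) lam T"
    and complete: "Metric_space.mcomplete X d"
    and progressive: "semi_progressive X (chain_rel X (dist_less X d \<epsilon>)) T"
  interpret Metric_space X d by fact
  let ?S = "dist_less X d \<epsilon>"
  have "refl_on X ?S" "sym ?S"
    using \<epsilon> by (auto simp: dist_less_def refl_on_def sym_def commute)
  moreover have "rel_complete X d ?S"
    using complete limitin_mspace
    unfolding rel_complete_def mcomplete_def converges_to_def by blast
  moreover have "rel_increasing X ?S T"
    unfolding rel_increasing_def
  proof (intro ballI impI)
    fix x y assume xy: "x \<in> X" "y \<in> X" "(x, y) \<in> ?S"
    then have "d (T x) (T y) \<le> lam * d x y"
      using contr by (simp add: contractive_def)
    also have "\<dots> \<le> d x y"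
      using lam by (simp add: mult_left_le_one_le)
    also have "\<dots> < \<epsilon>"
      using xy by (simp add: dist_less_def)
    finally show "(T x, T y) \<in> ?S"
      using xy T by (auto simp: dist_less_def)
  qed
  ultimately show "rel_global_strongly_Picard X d (chain_rel X ?S) T"
    using assms[unfolded AI_lin_rsms_def, rule_format, of X d T ?S] X T lam contr progressive
      dist_less_subset almost_selfclosed_dist_less[OF X(2) \<epsilon>] by blast
qed

section \<open>Concatenating infinitely many chains\<close>

text \<open>The chains \<open>p n 0, ..., p n (k n)\<close> fit together at their ends and are run through one after the
  other by a single sequence \<open>\<sigma>\<close>, the \<open>n\<close>-th of them starting at index \<open>K n\<close>. Every chain has
  at least one step, which makes \<open>K\<close> strictly increasing. The last clause serves to
  transfer properties of the steps of all chains to the steps of \<open>\<sigma>\<close>.\<close>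

lemma concatenate_chains:
  fixes p :: "nat \<Rightarrow> nat \<Rightarrow> 'a" and k :: "nat \<Rightarrow> nat"
  assumes k: "\<And>n. 0 < k n" and p: "\<And>n. p n (k n) = p (Suc n) 0"
  obtains \<sigma> K where "strict_mono K" "K 0 = 0" "\<And>n. K (Suc n) = K n + k n"
    "\<And>n j. j \<le> k n \<Longrightarrow> \<sigma> (K n + j) = p n j"
    "\<And>i. \<exists>n j. j < k n \<and> i = K n + j"
proof -
  define K where "K n = sum k {..<n}" for n
  define N where "N i = (LEAST n. i < K (Suc n))" for i
  define \<sigma> where "\<sigma> i = p (N i) (i - K (N i))" for i
  have mono: "strict_mono K"
    using k by (intro strict_monoI_Suc) (simp add: K_def)
  have K0: "K 0 = 0" and KS: "\<And>n. K (Suc n) = K n + k n"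
    by (simp_all add: K_def)
  have N: "N (K n + j) = n" if "j < k n" for n j
    unfolding N_def
  proof (rule Least_equality)
    show "K n + j < K (Suc n)"
      using that by (simp add: KS)
    fix m assume "K n + j < K (Suc m)"
    then have "K n < K (Suc m)" by simp
    then show "n \<le> m"
      using mono by (simp add: strict_mono_less less_Suc_eq_le)
  qed
  have \<sigma>: "\<sigma> (K n + j) = p n j" if "j \<le> k n" for n j
  proof (cases "j < k n")
    case True
    then show ?thesis by (simp add: \<sigma>_def N)
  next
    case False
    then have "K n + j = K (Suc n) + 0" "j = k n"
      using that by (auto simp: KS)
    then show ?thesis
      using N[of 0 "Suc n"] k p by (simp add: \<sigma>_def)
  qed
  have cover: "\<exists>n j. j < k n \<and> i = K n + j" for i
  proof (induction i)
    case 0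
    show ?case
      using k K0 by (metis add.right_neutral)
  next
    case (Suc i)
    then obtain n j where nj: "j < k n" "i = K n + j" by blast
    show ?case
    proof (cases "Suc j < k n")
      case True
      then show ?thesis using nj by (metis add_Suc_right)
    next
      case False
      then have "Suc i = K (Suc n) + 0"
        using nj by (simp add: KS)
      then show ?thesis using k by blast
    qed
  qed
  show ?thesis
    using mono K0 KS \<sigma> cover by (rule that)
qed

context Metric_space
begin

lemma dist_le_sum_steps:
  assumes "range \<sigma> \<subseteq> M" and "i \<le> j"
  shows "d (\<sigma> i) (\<sigma> j) \<le> (\<Sum>l=i..<j. d (\<sigma> l) (\<sigma> (Suc l)))"
  using \<open>i \<le> j\<close>
proof (induction j rule: dec_induct)
  case base
  have "\<sigma> i \<in> M" using assms(1) by blast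
  then show ?case by simp
next
  case (step j)
  have "d (\<sigma> i) (\<sigma> (Suc j)) \<le> d (\<sigma> i) (\<sigma> j) + d (\<sigma> j) (\<sigma> (Suc j))"
    using assms by (intro triangle) auto
  then show ?case
    using step by simp
qed

lemma MCauchy_if_summable_steps:
  assumes range: "range \<sigma> \<subseteq> M" and summable: "summable (\<lambda>i. d (\<sigma> i) (\<sigma> (Suc i)))"
  shows "MCauchy \<sigma>"
  unfolding MCauchy_def
proof (intro conjI allI impI)
  fix e :: real assume "e > 0"
  then obtain N where N: "\<And>m n. m \<ge> N \<Longrightarrow> norm (\<Sum>l=m..<n. d (\<sigma> l) (\<sigma> (Suc l))) < e"
    using summable unfolding summable_Cauchy by blast
  have "d (\<sigma> m) (\<sigma> n) < e" if "N \<le> m" "m \<le> n" for m n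
    using dist_le_sum_steps[OF range that(2)] N[OF that(1), of n] by simp
  then show "\<exists>N. \<forall>n n'. N \<le> n \<longrightarrow> N \<le> n' \<longrightarrow> d (\<sigma> n) (\<sigma> n') < e"
    by (metis commute nle_le)
qed (fact range)

lemma MCauchy_fast_subsequence:
  assumes "MCauchy w"
  obtains r :: "nat \<Rightarrow> nat" where "strict_mono r" "\<And>n. d (w (r n)) (w (r (Suc n))) < (1/2) ^ n"
proof -
  have "\<forall>n. \<exists>N. \<forall>i j. N \<le> i \<longrightarrow> N \<le> j \<longrightarrow> d (w i) (w j) < (1/2) ^ n"
    using assms unfolding MCauchy_def by simp
  then obtain N where N: "\<And>n i j. N n \<le> i \<Longrightarrow> N n \<le> j \<Longrightarrow> d (w i) (w j) < (1/2) ^ n"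
    by metis
  define r where "r n = (\<Sum>m\<le>n. Suc (N m))" for n
  have "strict_mono r"
    by (intro strict_monoI_Suc) (simp add: r_def)
  moreover have "d (w (r n)) (w (r (Suc n))) < (1/2) ^ n" for n
  proof (rule N)
    show "N n \<le> r n"
      by (cases n) (simp_all add: r_def)
    then show "N n \<le> r (Suc n)"
      by (simp add: r_def)
  qed
  ultimately show ?thesis
    by (rule that)
qed

end

section \<open>The chain metric\<close>

text \<open>Chains recorded only by their end points and their total length. The inductive form mirrors
  the transitive closure and makes composing and reversing chains a matter of induction;
  \<open>chain_length_obtain_vertices\<close> recovers the vertices.\<close>

inductive chain_length :: "('a \<Rightarrow> 'a \<Rightarrow> real) \<Rightarrow> 'a rel \<Rightarrow> 'a \<Rightarrow> 'a \<Rightarrow> real \<Rightarrow> bool" for d S where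
  edge: "(x, y) \<in> S \<Longrightarrow> chain_length d S x y (d x y)"
| step: "(x, y) \<in> S \<Longrightarrow> chain_length d S y z r \<Longrightarrow> chain_length d S x z (d x y + r)"

lemma chain_length_imp_trancl: "chain_length d S x y r \<Longrightarrow> (x, y) \<in> S\<^sup>+"
  by (induction rule: chain_length.induct) (auto intro: trancl_into_trancl2)

lemma trancl_imp_chain_length: "(x, y) \<in> S\<^sup>+ \<Longrightarrow> \<exists>r. chain_length d S x y r"
  by (induction rule: converse_trancl_induct) (auto intro: chain_length.intros)

lemma chain_length_trans:
  "chain_length d S x y r \<Longrightarrow> chain_length d S y z s \<Longrightarrow> chain_length d S x z (r + s)"
  by (induction rule: chain_length.induct) (auto intro: chain_length.intros simp: add.assoc)

lemma chain_length_sym: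
  assumes "chain_length d S x y r" and "sym S" and comm: "\<And>x y. d x y = d y x"
  shows "chain_length d S y x r"
  using assms(1)
proof induction
  case (edge x y)
  then have "(y, x) \<in> S"
    using \<open>sym S\<close> by (blast dest: symD)
  then show ?case
    using chain_length.edge comm by metis
next
  case (step x y z r)
  then have "(y, x) \<in> S"
    using \<open>sym S\<close> by (blast dest: symD)
  then have "chain_length d S y x (d x y)"
    using chain_length.edge comm by metis
  from chain_length_trans[OF step.IH this] show ?case
    by (simp add: add.commute)
qed

lemma chain_length_nonneg:
  "chain_length d S x y r \<Longrightarrow> (\<And>x y. 0 \<le> d x y) \<Longrightarrow> 0 \<le> r"
  by (induction rule: chain_length.induct) auto

lemma chain_length_obtain_vertices:
  assumes "chain_length d S x y r"
  obtains k p where "0 < k" "p 0 = x" "p k = y" "\<And>j. j < k \<Longrightarrow> (p j, p (Suc j)) \<in> S"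
    "(\<Sum>j<k. d (p j) (p (Suc j))) = r"
  using assms
proof (induction arbitrary: thesis)
  case (edge x y)
  show ?case
    by (rule edge.prems[of 1 "case_nat x (\<lambda>_. y)"]) (use edge.hyps in auto)
next
  case (step x y z r)
  obtain k p where p: "0 < k" "p 0 = y" "p k = z" "\<And>j. j < k \<Longrightarrow> (p j, p (Suc j)) \<in> S"
    "(\<Sum>j<k. d (p j) (p (Suc j))) = r"
    using step.IH by blast
  show ?case
  proof (rule step.prems[of "Suc k" "case_nat x p"])
    show "(case_nat x p j, case_nat x p (Suc j)) \<in> S" if "j < Suc k" for j
      using that step.hyps p by (cases j) auto
    show "(\<Sum>j<Suc k. d (case_nat x p j) (case_nat x p (Suc j))) = d x y + r"
      using p by (simp add: sum.lessThan_Suc_shift del: sum.lessThan_Suc)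
  qed (use p in auto)
qed

text \<open>The value \<open>0\<close> for points not joined by a chain is a default: \<open>Metric_space\<close> asks for
  nonnegativity and symmetry on the whole type, while the other metric axioms are only needed on
  the classes of the transitive closure.\<close>

definition chain_dist :: "('a \<Rightarrow> 'a \<Rightarrow> real) \<Rightarrow> 'a rel \<Rightarrow> 'a \<Rightarrow> 'a \<Rightarrow> real" where
  "chain_dist d S x y = (if (x, y) \<in> S\<^sup>+ then Inf {r. chain_length d S x y r} else 0)"

locale reflexive_symmetric_metric_space = Metric_space X d
  for X :: "'a set" and d + fixes S :: "'a rel"
  assumes S_subset: "S \<subseteq> X \<times> X" and S_refl: "refl_on X S" and S_sym: "sym S"
begin

abbreviation e where "e \<equiv> chain_dist d S"

definition component where "component x = {y. (x, y) \<in> S\<^sup>+}"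

lemma trancl_in_carrier: "(x, y) \<in> S\<^sup>+ \<Longrightarrow> x \<in> X \<and> y \<in> X"
  using trancl_subset_Sigma[OF S_subset] by (auto dest: subsetD)

lemma component_subset: "component x \<subseteq> X"
  using trancl_in_carrier by (simp add: component_def subset_iff)

lemma in_component_self: "x \<in> X \<Longrightarrow> x \<in> component x"
  using refl_onD[OF S_refl] by (simp add: component_def r_into_trancl)

lemma trancl_sym: "(x, y) \<in> S\<^sup>+ \<Longrightarrow> (y, x) \<in> S\<^sup>+"
  by (rule symD[OF sym_trancl[OF S_sym]])

lemma component_connected:
  "y \<in> component x \<Longrightarrow> z \<in> component x \<Longrightarrow> (y, z) \<in> S\<^sup>+"
  unfolding component_def by (blast intro: trancl_sym trancl_trans)

lemma chain_length_bdd_below: "bdd_below {r. chain_length d S x y r}"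
  by (rule bdd_belowI[of _ 0]) (simp add: chain_length_nonneg)

lemma chain_dist_le: "chain_length d S x y r \<Longrightarrow> e x y \<le> r"
  by (simp add: chain_dist_def chain_length_imp_trancl cInf_lower chain_length_bdd_below)

lemma chain_dist_greatest:
  assumes "(x, y) \<in> S\<^sup>+" and "\<And>r. chain_length d S x y r \<Longrightarrow> c \<le> r"
  shows "c \<le> e x y"
proof -
  have "c \<le> Inf {r. chain_length d S x y r}"
    using assms(2) trancl_imp_chain_length[OF assms(1), of d] by (intro cInf_greatest) blast+
  then show ?thesis
    using assms(1) by (simp add: chain_dist_def)
qed

lemma chain_dist_less_obtain:
  assumes "(x, y) \<in> S\<^sup>+" and "e x y < c"
  obtains r where "chain_length d S x y r" "r < c"
  using chain_dist_greatest[OF assms(1), of c] assms(2) by (meson not_le)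

lemma chain_dist_edge: "(x, y) \<in> S \<Longrightarrow> e x y \<le> d x y"
  by (rule chain_dist_le[OF chain_length.edge])

lemma dist_le_chain_length: "chain_length d S x y r \<Longrightarrow> d x y \<le> r"
proof (induction rule: chain_length.induct)
  case (step x y z r)
  have "x \<in> X" "y \<in> X" "z \<in> X"
    using trancl_in_carrier[OF r_into_trancl[OF step.hyps(1)]]
      trancl_in_carrier[OF chain_length_imp_trancl[OF step.hyps(2)]] by simp_all
  then show ?case
    using triangle[of x y z] step.IH by linarith
qed simp

lemma dist_le_chain_dist: "(x, y) \<in> S\<^sup>+ \<Longrightarrow> d x y \<le> e x y"
  by (rule chain_dist_greatest[OF _ dist_le_chain_length])

lemma chain_dist_nonneg: "0 \<le> e x y"
proof (cases "(x, y) \<in> S\<^sup>+")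
  case True
  then show ?thesis
    using dist_le_chain_dist order_trans[OF nonneg] by blast
qed (simp add: chain_dist_def)

lemma chain_dist_commute: "e x y = e y x"
proof -
  have "chain_length d S x y = chain_length d S y x"
    by (intro ext iffI) (rule chain_length_sym[OF _ S_sym commute], assumption)+
  then show ?thesis
    using trancl_sym[of x y] trancl_sym[of y x] by (auto simp: chain_dist_def)
qed

lemma chain_dist_triangle:
  assumes "(x, y) \<in> S\<^sup>+" "(y, z) \<in> S\<^sup>+"
  shows "e x z \<le> e x y + e y z"
proof -
  have "e x z - r \<le> e y z" if r: "chain_length d S x y r" for r
  proof (rule chain_dist_greatest[OF assms(2)])
    fix s assume "chain_length d S y z s"
    from chain_dist_le[OF chain_length_trans[OF r this]] show "e x z - r \<le> s"
      by simp
  qed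
  then have "e x z - e y z \<le> e x y"
    by (intro chain_dist_greatest[OF assms(1)]) (simp add: algebra_simps)
  then show ?thesis by simp
qed

lemma Metric_space_component: "Metric_space (component x) e"
proof
  fix y z assume yz: "y \<in> component x" "z \<in> component x"
  then have "y \<in> X" "z \<in> X"
    using component_subset by blast+
  show "e y z = 0 \<longleftrightarrow> y = z"
  proof
    assume "e y z = 0"
    then have "d y z \<le> 0"
      using dist_le_chain_dist component_connected yz by metis
    then show "y = z"
      using \<open>y \<in> X\<close> \<open>z \<in> X\<close> zero nonneg by (metis order_antisym)
  next
    assume "y = z"
    moreover have "(y, y) \<in> S"
      using S_refl \<open>y \<in> X\<close> by (rule refl_onD)
    ultimately have "e y z \<le> 0"
      using chain_dist_edge[of y y] \<open>y \<in> X\<close> by simp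
    then show "e y z = 0"
      using chain_dist_nonneg[of y z] by simp
  qed
next
  fix u v w assume "u \<in> component x" "v \<in> component x" "w \<in> component x"
  then show "e u w \<le> e u v + e v w"
    by (intro chain_dist_triangle component_connected)
qed (use chain_dist_nonneg chain_dist_commute in auto)

text \<open>Since \<open>d \<le> e\<close> on a class, \<open>e\<close>-convergence is the stronger notion.\<close>

lemma limitin_component_imp_limitin:
  assumes "limitin (Metric_space.mtopology (component x) e) \<sigma> z sequentially"
  shows "limitin mtopology \<sigma> z sequentially"
proof -
  interpret E: Metric_space "component x" e
    by (rule Metric_space_component)
  have "\<exists>N. \<forall>n\<ge>N. \<sigma> n \<in> X \<and> d (\<sigma> n) z < \<epsilon>" if "\<epsilon> > 0" for \<epsilon>
  proof -
    obtain N where N: "\<forall>n\<ge>N. \<sigma> n \<in> component x \<and> e (\<sigma> n) z < \<epsilon>"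
      using assms \<open>\<epsilon> > 0\<close> unfolding E.limit_metric_sequentially by blast
    have "d (\<sigma> n) z < \<epsilon>" if "n \<ge> N" for n
    proof -
      have "d (\<sigma> n) z \<le> e (\<sigma> n) z"
        using N that E.limitin_mspace[OF assms]
        by (intro dist_le_chain_dist component_connected) auto
      also have "\<dots> < \<epsilon>"
        using N that by blast
      finally show ?thesis .
    qed
    then show ?thesis
      using N component_subset by blast
  qed
  then show ?thesis
    using E.limitin_mspace[OF assms] component_subset
    unfolding limit_metric_sequentially by blast
qed

text \<open>Concatenating short chains between the terms of a fast subsequence of an \<open>e\<close>-Cauchy sequence
  \<open>w\<close> gives an ascending sequence \<open>\<sigma>\<close> whose steps have a finite sum. That makes \<open>\<sigma>\<close> Cauchy for both
  metrics: for \<open>d\<close>, so that a limit \<open>z\<close> exists, and for \<open>e\<close>, so that \<open>e\<close>-convergence of a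
  subsequence of \<open>\<sigma>\<close> is enough. From \<open>\<sigma>\<close> the limit passes to the fast subsequence, which is a
  subsequence of \<open>\<sigma>\<close> as well, and finally to \<open>w\<close>.\<close>

lemma mcomplete_component:
  assumes complete: "rel_complete X d S" and closed: "almost_selfclosed X d S"
  shows "Metric_space.mcomplete (component x) e"
proof -
  interpret E: Metric_space "component x" e
    by (rule Metric_space_component)
  show ?thesis
    unfolding E.mcomplete_def
  proof (intro allI impI)
    fix w assume w: "E.MCauchy w"
    then have w_in: "w i \<in> component x" for i
      by (auto simp: E.MCauchy_def)
    obtain r :: "nat \<Rightarrow> nat" where r: "strict_mono r"
      and fast: "\<And>n. e (w (r n)) (w (r (Suc n))) < (1/2) ^ n"
      using E.MCauchy_fast_subsequence[OF w] by blast
    define short_chain where "short_chain n k p \<longleftrightarrow>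
      0 < k \<and> p 0 = w (r n) \<and> p k = w (r (Suc n)) \<and>
      (\<forall>j<k. (p j, p (Suc j)) \<in> S) \<and> (\<Sum>j<k. d (p j) (p (Suc j))) < (1/2) ^ n"
      for n k and p :: "nat \<Rightarrow> 'a"
    have "\<exists>k p. short_chain n k p" for n
    proof -
      obtain l where l: "chain_length d S (w (r n)) (w (r (Suc n))) l" "l < (1/2) ^ n"
        using chain_dist_less_obtain[OF component_connected fast] w_in by blast
      obtain k p where "0 < k" "p 0 = w (r n)" "p k = w (r (Suc n))"
        "\<And>j. j < k \<Longrightarrow> (p j, p (Suc j)) \<in> S" "(\<Sum>j<k. d (p j) (p (Suc j))) = l"
        by (rule chain_length_obtain_vertices[OF l(1)]) (rule that)
      then have "short_chain n k p"
        using l(2) by (simp add: short_chain_def)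
      then show ?thesis
        by blast
    qed
    then obtain k p where "\<And>n. short_chain n (k n) (p n)"
      by metis
    then have k: "\<And>n. 0 < k n" and p: "\<And>n. p n 0 = w (r n)"
      "\<And>n. p n (k n) = w (r (Suc n))" "\<And>n j. j < k n \<Longrightarrow> (p n j, p n (Suc j)) \<in> S"
      "\<And>n. (\<Sum>j<k n. d (p n j) (p n (Suc j))) < (1/2) ^ n"
      by (simp_all add: short_chain_def)
    have consecutive: "p n (k n) = p (Suc n) 0" for n
      by (simp add: p)
    obtain \<sigma> K where K: "strict_mono K" "K 0 = 0" "\<And>n. K (Suc n) = K n + k n"
      and \<sigma>: "\<And>n j. j \<le> k n \<Longrightarrow> \<sigma> (K n + j) = p n j"
      and cover: "\<And>i. \<exists>n j. j < k n \<and> i = K n + j"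
      by (rule concatenate_chains[of k p, OF k consecutive]) (rule that)
    have \<sigma>K: "\<sigma> \<circ> K = w \<circ> r"
      using \<sigma>[of 0] p(1) by (auto simp: fun_eq_iff)
    have ascending: "(\<sigma> i, \<sigma> (Suc i)) \<in> S" for i
    proof -
      obtain n j where "j < k n" "i = K n + j"
        using cover by blast
      then show ?thesis
        using p(3)[of j n] \<sigma>[of j n] \<sigma>[of "Suc j" n] by simp
    qed
    have \<sigma>_in: "\<sigma> i \<in> component x" for i
    proof (induction i)
      case 0
      show ?case
        using fun_cong[OF \<sigma>K, of 0] K(2) w_in by simp
    next
      case (Suc i)
      then show ?case
        using ascending[of i] by (auto simp: component_def intro: trancl_into_trancl)
    qed
    have split_sum: "(\<Sum>i<a + b. f i) = (\<Sum>i<a. f i) + (\<Sum>j<b. f (a + j))"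
      for a b and f :: "nat \<Rightarrow> real"
      by (induction b) simp_all
    have blocks: "(\<Sum>i<K n. d (\<sigma> i) (\<sigma> (Suc i))) \<le> (\<Sum>m<n. (1/2) ^ m)" for n
    proof (induction n)
      case 0
      show ?case by (simp add: K)
    next
      case (Suc n)
      have "(\<Sum>i<K (Suc n). d (\<sigma> i) (\<sigma> (Suc i)))
          = (\<Sum>i<K n. d (\<sigma> i) (\<sigma> (Suc i))) + (\<Sum>j<k n. d (\<sigma> (K n + j)) (\<sigma> (Suc (K n + j))))"
        unfolding K(3) by (rule split_sum)
      also have "(\<Sum>j<k n. d (\<sigma> (K n + j)) (\<sigma> (Suc (K n + j)))) = (\<Sum>j<k n. d (p n j) (p n (Suc j)))"
        using \<sigma> by (intro sum.cong) (auto simp flip: add_Suc_right)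
      finally show ?case
        using Suc p(4)[of n] by simp
    qed
    have summable_d: "summable (\<lambda>i. d (\<sigma> i) (\<sigma> (Suc i)))"
    proof (rule summableI_nonneg_bounded)
      fix n
      have "(\<Sum>i<n. d (\<sigma> i) (\<sigma> (Suc i))) \<le> (\<Sum>i<K n. d (\<sigma> i) (\<sigma> (Suc i)))"
        using strict_mono_imp_increasing[OF K(1), of n] by (intro sum_mono2) auto
      also have "\<dots> \<le> (\<Sum>m<n. (1/2) ^ m)"
        by (rule blocks)
      also have "\<dots> \<le> (\<Sum>m. (1/2) ^ m)"
        by (intro sum_le_suminf) auto
      finally show "(\<Sum>i<n. d (\<sigma> i) (\<sigma> (Suc i))) \<le> (\<Sum>m. (1/2) ^ m)" .
    qed simp
    have "summable (\<lambda>i. e (\<sigma> i) (\<sigma> (Suc i)))"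
      using chain_dist_edge[OF ascending] chain_dist_nonneg
      by (intro summable_comparison_test'[OF summable_d, of 0]) simp
    then have cauchy_e: "E.MCauchy \<sigma>"
      using \<sigma>_in by (intro E.MCauchy_if_summable_steps) auto
    have "MCauchy \<sigma>"
      using summable_d \<sigma>_in component_subset by (intro MCauchy_if_summable_steps) auto
    then obtain z where z: "converges_to X d \<sigma> z"
      using complete ascending unfolding rel_complete_def ascending_def by blast
    then obtain \<rho> :: "nat \<Rightarrow> nat" where \<rho>: "strict_mono \<rho>" "\<And>n. (\<sigma> (\<rho> n), z) \<in> S"
      using closed ascending unfolding almost_selfclosed_def ascending_def by blast
    have z_in: "z \<in> component x"
      using \<sigma>_in[of "\<rho> 0"] \<rho>(2)[of 0] by (auto simp: component_def intro: trancl_into_trancl)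
    \<comment> \<open>Along \<open>\<rho>\<close> the terms are one step away from \<open>z\<close>, where \<open>e\<close> is bounded by \<open>d\<close>.\<close>
    have "limitin E.mtopology (\<sigma> \<circ> \<rho>) z sequentially"
      unfolding E.limit_metric_sequentially
    proof (intro conjI allI impI)
      fix \<epsilon> :: real assume "\<epsilon> > 0"
      moreover have "limitin mtopology (\<sigma> \<circ> \<rho>) z sequentially"
        using z \<rho>(1) by (intro limitin_subsequence) (simp_all add: converges_to_def)
      ultimately obtain N where "\<forall>n\<ge>N. d ((\<sigma> \<circ> \<rho>) n) z < \<epsilon>"
        unfolding limit_metric_sequentially by blast
      then show "\<exists>N. \<forall>n\<ge>N. (\<sigma> \<circ> \<rho>) n \<in> component x \<and> e ((\<sigma> \<circ> \<rho>) n) z < \<epsilon>"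
        using \<sigma>_in chain_dist_edge[OF \<rho>(2)] by (metis comp_apply order_le_less_trans)
    qed (fact z_in)
    then have "limitin E.mtopology \<sigma> z sequentially"
      by (rule E.MCauchy_convergent_subsequence[OF cauchy_e \<rho>(1)])
    then have "limitin E.mtopology (w \<circ> r) z sequentially"
      using limitin_subsequence[OF K(1)] \<sigma>K by metis
    then have "limitin E.mtopology w z sequentially"
      by (rule E.MCauchy_convergent_subsequence[OF w r])
    then show "\<exists>z. limitin E.mtopology w z sequentially" ..
  qed
qed

lemma trancl_increasing:
  assumes incr: "rel_increasing X S T" and "(y, z) \<in> S\<^sup>+"
  shows "(T y, T z) \<in> S\<^sup>+"
proof -
  have step: "(T u, T v) \<in> S" if "(u, v) \<in> S" for u v
    using incr that S_subset unfolding rel_increasing_def by blast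
  from assms(2) show ?thesis
    by (induction rule: trancl_induct) (auto intro: step trancl_into_trancl)
qed

text \<open>The image under \<open>T\<close> of a chain is a chain, each step of which is shortened by the factor
  \<open>lam\<close>.\<close>

lemma chain_length_contractive:
  assumes incr: "rel_increasing X S T" and contr: "contractive X d S lam T"
    and "chain_length d S y z r"
  shows "e (T y) (T z) \<le> lam * r"
  using assms(3)
proof induction
  case (edge y z)
  then have "(T y, T z) \<in> S" "d (T y) (T z) \<le> lam * d y z"
    using incr contr S_subset unfolding rel_increasing_def contractive_def by blast+
  then show ?case
    using chain_dist_edge order_trans by blast
next
  case (step u v z r)
  then have edge: "(T u, T v) \<in> S" "d (T u) (T v) \<le> lam * d u v"
    using incr contr S_subset unfolding rel_increasing_def contractive_def by blast+
  have "e (T u) (T z) \<le> e (T u) (T v) + e (T v) (T z)"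
    using edge(1) trancl_increasing[OF incr chain_length_imp_trancl[OF step.hyps(2)]]
    by (intro chain_dist_triangle) auto
  also have "\<dots> \<le> lam * d u v + lam * r"
    using chain_dist_edge[OF edge(1)] edge(2) step.IH by linarith
  finally show ?case
    by (simp add: algebra_simps)
qed

lemma chain_dist_contractive:
  assumes incr: "rel_increasing X S T" and contr: "contractive X d S lam T"
    and "0 < lam" and yz: "(y, z) \<in> S\<^sup>+"
  shows "e (T y) (T z) \<le> lam * e y z"
proof -
  have "e (T y) (T z) / lam \<le> e y z"
    using chain_length_contractive[OF incr contr] \<open>0 < lam\<close>
    by (intro chain_dist_greatest[OF yz]) (simp add: field_simps)
  then show ?thesis
    using \<open>0 < lam\<close> by (simp add: field_simps)
qed

lemma maps_component:
  assumes "rel_increasing X S T" and "(x, T x) \<in> S\<^sup>+"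
  shows "T \<in> component x \<rightarrow> component x"
  using trancl_increasing[OF assms(1)] assms(2) by (auto simp: component_def intro: trancl_trans)

lemma Picard_component:
  assumes B: "B_cp_ms TYPE('a)"
    and contr: "contractive X d S lam T" "0 < lam" "lam < 1"
    and complete: "rel_complete X d S" and closed: "almost_selfclosed X d S"
    and incr: "rel_increasing X S T" and x: "(x, T x) \<in> S\<^sup>+"
  shows "global_strongly_Picard (component x) e T"
proof -
  have "component x \<noteq> {}"
    using x by (auto simp: component_def)
  moreover have "\<forall>y\<in>component x. \<forall>z\<in>component x. e (T y) (T z) \<le> lam * e y z"
    using chain_dist_contractive[OF incr contr(1,2)] component_connected by blast
  ultimately show ?thesis
    using B[unfolded B_cp_ms_def, rule_format, of "component x" e T] Metric_space_component
      maps_component[OF incr x] mcomplete_component[OF complete closed] less_imp_le[OF contr(2)]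
      contr(3) by blast
qed

end

text \<open>Both halves of the conclusion come from the Banach principle on a class that \<open>T\<close> maps into
  itself: the class of the starting point for convergence, and the class of one of the two fixed
  points for uniqueness.\<close>

lemma AI_lin_rsms_if_B_cp_ms:
  assumes B: "B_cp_ms TYPE('a)"
  shows "AI_lin_rsms TYPE('a)"
  unfolding AI_lin_rsms_def
proof (intro allI impI, elim conjE exE)
  fix X :: "'a set" and d T S and lam :: real
  assume X: "Metric_space X d" and S: "S \<subseteq> X \<times> X" "refl_on X S" "sym S"
    and lam: "0 < lam" "lam < 1" and contr: "contractive X d S lam T"
    and complete: "rel_complete X d S" and closed: "almost_selfclosed X d S"
    and incr: "rel_increasing X S T"
  interpret reflexive_symmetric_metric_space X d S
    using X S by (intro reflexive_symmetric_metric_space.intro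
        reflexive_symmetric_metric_space_axioms.intro)
  have Picard: "global_strongly_Picard (component x) e T" if "(x, T x) \<in> S\<^sup>+" for x
    by (rule Picard_component[OF B contr lam complete closed incr that])
  show "rel_global_strongly_Picard X d (chain_rel X S) T"
    unfolding rel_global_strongly_Picard_def chain_rel_eq_trancl[OF S(1)]
  proof (intro conjI ballI impI)
    fix x assume "x \<in> progress_set X (S\<^sup>+) T"
    then have x: "x \<in> X" "(x, T x) \<in> S\<^sup>+"
      by (auto simp: progress_set_def)
    then obtain z where z: "z \<in> Fix (component x) T"
      and lim: "converges_to (component x) e (\<lambda>n. (T ^^ n) x) z"
      using Picard[OF x(2)] in_component_self[OF x(1)] unfolding global_strongly_Picard_def by blast
    have "z \<in> Fix X T"
      using z component_subset by (auto simp: Fix_def)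
    moreover have "converges_to X d (\<lambda>n. (T ^^ n) x) z"
      using lim unfolding converges_to_def by (rule limitin_component_imp_limitin)
    ultimately show "\<exists>z\<in>Fix X T. converges_to X d (\<lambda>n. (T ^^ n) x) z"
      by blast
  next
    fix z1 z2 assume z: "z1 \<in> Fix X T" "z2 \<in> Fix X T" and z12: "(z1, z2) \<in> S\<^sup>+"
    then have "z1 \<in> Fix (component z1) T" "z2 \<in> Fix (component z1) T"
      using in_component_self by (auto simp: Fix_def component_def)
    moreover have "global_strongly_Picard (component z1) e T"
      using z(1) in_component_self[of z1] by (intro Picard) (simp add: Fix_def component_def)
    ultimately show "z1 = z2"
      unfolding global_strongly_Picard_def by blast
  qed
qed

theorem proposition5p2:
  shows "(B_cp_bdms TYPE('a) \<longrightarrow> B_cp_ms TYPE('a)) \<and>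
         (E_cp_ms TYPE('a) \<longrightarrow> B_cp_bdms TYPE('a)) \<and>
         (AI_lin_rsms TYPE('a) \<longrightarrow> E_cp_ms TYPE('a)) \<and>
         (B_cp_ms TYPE('a) \<longrightarrow> AI_lin_rsms TYPE('a)) \<and>
         (B_cp_ms TYPE('a) \<longleftrightarrow> B_cp_bdms TYPE('a)) \<and>
         (B_cp_ms TYPE('a) \<longleftrightarrow> E_cp_ms TYPE('a)) \<and>
         (B_cp_ms TYPE('a) \<longleftrightarrow> AI_lin_rsms TYPE('a)) \<and>
         (B_cp_bdms TYPE('a) \<longleftrightarrow> E_cp_ms TYPE('a)) \<and>
         (B_cp_bdms TYPE('a) \<longleftrightarrow> AI_lin_rsms TYPE('a)) \<and>
         (E_cp_ms TYPE('a) \<longleftrightarrow> AI_lin_rsms TYPE('a))"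
  using B_cp_ms_if_B_cp_bdms B_cp_bdms_if_E_cp_ms E_cp_ms_if_AI_lin_rsms AI_lin_rsms_if_B_cp_ms
  by blast

end
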